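(* Let $U$ be a Hilbert space and $N\ge 1$. Let $\tilde H_{i+1}:U\rightrightarrows U$ and $\Gamma_{i+1}\in\mathcal L(U;U)$ for $i=0,\dots,N-1$, and let $M_{i+1},Z_{i+1},\Lambda_{i+1}\in\mathcal L(U;U)$ for $i=0,\dots,N$, with every $\Lambda_{i+1}$ invertible. Given $u^0=\bar u^0\in U$, let $u^1,\dots,u^N$ be such that for $i=0,\dots,N-1$ $$0\in \tilde H_{i+1}(u^{i+1})+M_{i+1}(u^{i+1}-\bar u^i)+\Gamma_{i+1}(\Lambda_{i+1}^{-1}-I)(u^{i+1}-u^i),$$ $$\bar u^{i+1}:=u^{i+1}+\Lambda_{i+2}(\Lambda_{i+1}^{-1}-I)(u^{i+1}-u^i),$$ and define the auxiliary sequence by $z^0:=u^0$ and $z^{i+1}:=\Lambda_{i+1}^{-1}u^{i+1}-(\Lambda_{i+1}^{-1}-I)u^i$ for $i=0,\dots,N-1$. Suppose that $Z_{i+1}M_{i+1}\ge 0$ is self-adjoint for $i=0,\dots,N$, and that for some $\widehat u\in U$ and some real numbers $\mathcal V_{i+1}(\widehat u)\in\mathbb R$ the following two conditions hold for $i=0,\dots,N-1$: $$\langle \tilde H_{i+1}(u^{i+1})-\Gamma_{i+1}(u^{i+1}-\widehat u),\, z^{i+1}-\widehat u\rangle_{\Lambda_{i+1}^*Z_{i+1}}\ \ge\ \mathcal V_{i+1}(\widehat u)-\tfrac12\|z^{i+1}-z^i\|^2_{\Lambda_{i+1}^*Z_{i+1}M_{i+1}\Lambda_{i+1}}$$ and $$\Lambda_{i+1}^*Z_{i+1}(M_{i+1}\Lambda_{i+1}+2\Gamma_{i+1})\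 \ge\ \Lambda_{i+2}^*Z_{i+2}M_{i+2}\Lambda_{i+2}.$$ Then $$\tfrac12\|z^N-\widehat u\|^2_{\Lambda_{N+1}^*Z_{N+1}M_{N+1}\Lambda_{N+1}}+\sum_{i=0}^{N-1}\mathcal V_{i+1}(\widehat u)\ \le\ \tfrac12\|z^0-\widehat u\|^2_{\Lambda_1^*Z_1M_1\Lambda_1}.$$
   Context: Hilbert spaces are real. $\mathcal L(X;Y)$ is the space of bounded linear operators from $X$ to $Y$; $H:U\rightrightarrows U$ denotes a set-valued map. For $T,S\in\mathcal L(U;U)$ (not necessarily self-adjoint), $T\ge S$ means that $T-S$ is positive semidefinite, i.e. $\langle (T-S)x,x\rangle\ge0$ for all $x$. For possibly non-self-adjoint $T$, $\langle x,z\rangle_T:=\langle Tx,z\rangle$, and for positive semidefinite $T$, $\|x\|_T:=\sqrt{\langle x,x\rangle_T}$. For a set $A\subset\mathbb R$ and $c\in\mathbb R$, $A\ge c$ means $t\ge c$ for all $t\in A$; thus an inequality involving the set $\tilde H_{i+1}(u^{i+1})$ is required for each of its elements. *)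

theory Defs
  imports "HOL-Analysis.Analysis"
begin

text \<open>
  A real Hilbert space is a type of sort \<open>{real_inner, complete_space}\<close>; the space
  of bounded linear operators is the library's \<open>'u \<Rightarrow>\<^sub>L 'u\<close>, with composition \<open>o\<^sub>L\<close>
  and identity \<open>id_blinfun\<close>.
\<close>

definition inverse_op :: "('u::real_normed_vector \<Rightarrow>\<^sub>L 'u) \<Rightarrow> ('u \<Rightarrow>\<^sub>L 'u) \<Rightarrow> bool" where
  "inverse_op T S \<longleftrightarrow> T o\<^sub>L S = id_blinfun \<and> S o\<^sub>L T = id_blinfun"

definition invertible_op :: "('u::real_normed_vector \<Rightarrow>\<^sub>L 'u) \<Rightarrow> bool" where
  "invertible_op T \<longleftrightarrow> (\<exists>S. inverse_op T S)"

definition inv_op :: "('u::real_normed_vector \<Rightarrow>\<^sub>L 'u) \<Rightarrow> ('u \<Rightarrow>\<^sub>L 'u)" where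
  "inv_op T = (THE S. inverse_op T S)"

text \<open>
  The library's \<open>adjoint\<close> is a choice operator on plain functions whose
  properties are only proved there for Euclidean spaces. Lemma \<open>adj_op_works\<close> below
  shows that on a Hilbert space it yields the (bounded) Hilbert adjoint.
\<close>

definition adj_op :: "('u::{real_inner, complete_space} \<Rightarrow>\<^sub>L 'u) \<Rightarrow> ('u \<Rightarrow>\<^sub>L 'u)" where
  "adj_op T = Blinfun (adjoint (blinfun_apply T))"

definition selfadjoint_op :: "('u::{real_inner, complete_space} \<Rightarrow>\<^sub>L 'u) \<Rightarrow> bool" where
  "selfadjoint_op T \<longleftrightarrow> adj_op T = T"

text \<open>Positive semidefiniteness does not include self-adjointness.\<close>

definition psd_op :: "('u::real_inner \<Rightarrow>\<^sub>L 'u) \<Rightarrow> bool" where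
  "psd_op T \<longleftrightarrow> (\<forall>x. 0 \<le> inner (blinfun_apply T x) x)"

definition ge_op :: "('u::real_inner \<Rightarrow>\<^sub>L 'u) \<Rightarrow> ('u \<Rightarrow>\<^sub>L 'u) \<Rightarrow> bool" (infix \<open>\<succeq>\<close> 50) where
  "T \<succeq> S \<longleftrightarrow> psd_op (T - S)"

definition inner_op :: "('u::real_inner \<Rightarrow>\<^sub>L 'u) \<Rightarrow> 'u \<Rightarrow> 'u \<Rightarrow> real" where
  "inner_op T x z = inner (blinfun_apply T x) z"

text \<open>Only meaningful for \<open>psd_op T\<close>: the library's \<open>sqrt\<close> is odd on negative arguments.\<close>

definition norm_op :: "('u::real_inner \<Rightarrow>\<^sub>L 'u) \<Rightarrow> 'u \<Rightarrow> real" where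
  "norm_op T x = sqrt (inner_op T x x)"


lemma inv_op_works:
  assumes "invertible_op T"
  shows "inverse_op T (inv_op T)"
proof -
  obtain S where S: "inverse_op T S"
    using assms by (auto simp: invertible_op_def)
  have "S' = S" if "inverse_op T S'" for S'
  proof (rule blinfun_eqI)
    fix x
    have "S' x = S' ((T o\<^sub>L S) x)" using S by (simp add: inverse_op_def)
    also have "\<dots> = (S' o\<^sub>L T) (S x)" by simp
    also have "\<dots> = S x" using that unfolding inverse_op_def by simp
    finally show "S' x = S x" .
  qed
  with S show ?thesis unfolding inv_op_def by (metis theI)
qed

lemma riesz_representation:
  fixes f :: "'u::{real_inner, complete_space} \<Rightarrow> real"
  assumes "bounded_linear f"
  shows "\<exists>a. \<forall>x. f x = inner x a"
proof -
  interpret f: bounded_linear f by fact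
  obtain K where K: "\<And>x. norm (f x) \<le> norm x * K" using f.bounded by blast
  define J where "J x = inner x x - 2 * f x" for x
  have lower: "- K\<^sup>2 \<le> J x" for x
  proof -
    have "f x \<le> norm x * K" using K[of x] by simp
    moreover have "0 \<le> (norm x - K)\<^sup>2" by simp
    ultimately show ?thesis
      by (simp add: J_def power2_norm_eq_inner[symmetric] power2_diff)
  qed
  define m where "m = Inf (range J)"
  have bdd: "bdd_below (range J)" using lower by (auto intro!: bdd_belowI)
  have mJ: "m \<le> J x" for x
    unfolding m_def by (intro cInf_lower bdd) auto
  have "\<exists>x. J x < m + inverse (real (Suc n))" for n
  proof -
    have "Inf (range J) < m + inverse (real (Suc n))" by (simp add: m_def)
    then show ?thesis by (subst (asm) cInf_less_iff) (use bdd in auto)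
  qed
  then obtain X where X: "\<And>n. J (X n) < m + inverse (real (Suc n))" by metis
  have par: "(dist x y)\<^sup>2 \<le> 2 * (J x - m) + 2 * (J y - m)" for x y
  proof -
    have "(dist x y)\<^sup>2 = 2 * J x + 2 * J y - 4 * J ((1/2) *\<^sub>R (x + y))"
      by (simp add: J_def dist_norm power2_norm_eq_inner f.scaleR f.add inner_diff_left
          inner_diff_right inner_add_left inner_add_right inner_commute algebra_simps)
    then show ?thesis using mJ[of "(1/2) *\<^sub>R (x + y)"] by simp
  qed
  have "Cauchy X"
  proof (rule metric_CauchyI)
    fix e :: real assume e: "0 < e"
    obtain N where N: "inverse (real (Suc N)) < e\<^sup>2 / 4"
      using reals_Archimedean[of "e\<^sup>2 / 4"] e by auto
    have small: "J (X n) - m < e\<^sup>2 / 4" if "n \<ge> N" for n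
    proof -
      have "inverse (real (Suc n)) \<le> inverse (real (Suc N))" using that by simp
      with X[of n] N show ?thesis by linarith
    qed
    have "dist (X k) (X n) < e" if "k \<ge> N" "n \<ge> N" for k n
    proof -
      have "(dist (X k) (X n))\<^sup>2 \<le> 2 * (J (X k) - m) + 2 * (J (X n) - m)" by (rule par)
      also have "\<dots> < 2 * (e\<^sup>2 / 4) + 2 * (e\<^sup>2 / 4)"
        by (intro add_strict_mono mult_strict_left_mono small that) auto
      also have "\<dots> = e\<^sup>2" by simp
      finally have "(dist (X k) (X n))\<^sup>2 < e\<^sup>2" .
      with e show ?thesis by (meson less_imp_le power_less_imp_less_base)
    qed
    then show "\<exists>M. \<forall>k\<ge>M. \<forall>n\<ge>M. dist (X k) (X n) < e" by blast
  qed
  then obtain a where a: "X \<longlonglongrightarrow> a"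
    using Cauchy_convergent convergent_def by blast
  have "(\<lambda>n. J (X n)) \<longlonglongrightarrow> J a"
    unfolding J_def by (intro tendsto_intros a f.tendsto)
  moreover have "(\<lambda>n. m + inverse (real (Suc n))) \<longlonglongrightarrow> m + 0"
    by (intro tendsto_add tendsto_const LIMSEQ_inverse_real_of_nat)
  ultimately have "J a \<le> m + 0"
    by (rule LIMSEQ_le) (use X less_imp_le in blast)
  then have Ja: "J a \<le> J x" for x using mJ[of x] by simp
  have "f x = inner x a" for x
  proof (rule ccontr)
    assume ne: "f x \<noteq> inner x a"
    define d where "d = f x - inner x a"
    have quad: "2 * t * d \<le> t\<^sup>2 * inner x x" for t
      using Ja[of "a + t *\<^sub>R x"]
      by (simp add: J_def d_def f.add f.scaleR inner_add_left inner_add_right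
          inner_commute power2_eq_square algebra_simps)
    have pos: "inner x x > 0" using ne f.zero by (metis inner_gt_zero_iff inner_zero_left)
    have "2 * (d / inner x x) * d \<le> (d / inner x x)\<^sup>2 * inner x x" by (rule quad)
    also have "\<dots> = d\<^sup>2 / inner x x" using pos by (simp add: power2_eq_square)
    finally have "d\<^sup>2 / inner x x \<le> 0" by (simp add: power2_eq_square)
    then have "d\<^sup>2 \<le> 0" using pos by (metis linorder_not_less divide_pos_pos)
    with ne show False by (simp add: d_def)
  qed
  then show ?thesis by blast
qed

lemma adj_op_works:
  fixes T :: "'u::{real_inner, complete_space} \<Rightarrow>\<^sub>L 'u"
  shows "inner (T x) y = inner x (adj_op T y)"
proof -
  have "\<exists>a. \<forall>x. inner (T x) y = inner x a" for y
    by (intro riesz_representation bounded_linear_intros)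
  then have "\<exists>g. \<forall>x y. inner (T x) y = inner x (g y)" by metis
  then have ad: "\<forall>x y. inner (T x) y = inner x (adjoint (blinfun_apply T) y)"
    unfolding adjoint_def by (rule someI_ex)
  let ?S = "adjoint (blinfun_apply T)"
  have "bounded_linear ?S"
  proof (rule bounded_linear_intro[where K = "norm T"])
    fix y z :: 'u and r :: real
    have "inner x (?S (y + z)) = inner x (?S y + ?S z)" for x
      using ad by (metis inner_add_right)
    then show "?S (y + z) = ?S y + ?S z" using vector_eq_rdot by (metis inner_commute)
    have "inner x (?S (r *\<^sub>R y)) = inner x (r *\<^sub>R ?S y)" for x
      using ad by (metis inner_scaleR_right)
    then show "?S (r *\<^sub>R y) = r *\<^sub>R ?S y" using vector_eq_rdot by (metis inner_commute)
    have "norm (?S y) * norm (?S y) = inner (T (?S y)) y"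
      using ad by (simp add: power2_norm_eq_inner flip: power2_eq_square)
    also have "\<dots> \<le> norm (T (?S y)) * norm y" by (rule norm_cauchy_schwarz)
    also have "\<dots> \<le> norm T * norm (?S y) * norm y"
      by (intro mult_right_mono norm_blinfun norm_ge_zero)
    finally show "norm (?S y) \<le> norm y * norm T"
      by (cases "norm (?S y) = 0") (auto simp: mult_ac)
  qed
  with ad show ?thesis by (simp add: adj_op_def bounded_linear_Blinfun_apply)
qed

end

theory Submission
  imports Defs
begin

text \<open>
  In terms of the auxiliary sequence the method is a plain preconditioned proximal point method:
  \<open>z\<^sup>i\<^sup>+\<^sup>1 - u\<^sup>i\<^sup>+\<^sup>1 = (\<Lambda>\<^sup>-\<^sup>1 - I)(u\<^sup>i\<^sup>+\<^sup>1 - u\<^sup>i)\<close> and \<open>u\<^sup>i\<^sup>+\<^sup>1 - ubar\<^sup>i = \<Lambda>(z\<^sup>i\<^sup>+\<^sup>1 - z\<^sup>i)\<close>, so the inclusion provides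
  \<open>h \<in> H(u\<^sup>i\<^sup>+\<^sup>1)\<close> with \<open>h - \<Gamma>(u\<^sup>i\<^sup>+\<^sup>1 - uhat) = - M \<Lambda> (z\<^sup>i\<^sup>+\<^sup>1 - z\<^sup>i) - \<Gamma>(z\<^sup>i\<^sup>+\<^sup>1 - uhat)\<close>. Testing this with
  \<open>z\<^sup>i\<^sup>+\<^sup>1 - uhat\<close> and expanding the first term by the three-point identity of the self-adjoint
  operator \<open>\<Lambda>\<^sup>* Z M \<Lambda>\<close>, the metric update turns the result into a one-step descent
  estimate, which telescopes.
\<close>

lemma inv_op_right:
  assumes "invertible_op T"
  shows "T (inv_op T x) = x"
  using inv_op_works[OF assms] unfolding inverse_op_def
  by (metis blinfun_apply_blinfun_compose id_blinfun.rep_eq)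

lemma inner_adj_op_left:
  fixes T :: "'u::{real_inner, complete_space} \<Rightarrow>\<^sub>L 'u"
  shows "inner (adj_op T x) y = inner x (T y)"
  by (metis adj_op_works inner_commute)

lemma inner_op_congruence:
  fixes L P :: "'u::{real_inner, complete_space} \<Rightarrow>\<^sub>L 'u"
  shows "inner_op (adj_op L o\<^sub>L P) x y = inner (P x) (L y)"
  by (simp add: inner_op_def inner_adj_op_left)

lemma selfadjoint_op_inner:
  assumes "selfadjoint_op T"
  shows "inner (T x) y = inner (T y) x"
  using assms adj_op_works[of T x y] by (simp add: selfadjoint_op_def inner_commute)

text \<open>The quadratic form at \<open>x\<close> is that of \<open>P\<close> at
  \<open>L x\<close>. Positivity is what makes squaring \<open>norm_op\<close> return the form
  itself.\<close>

lemma psd_op_congruence: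
  fixes L P :: "'u::{real_inner, complete_space} \<Rightarrow>\<^sub>L 'u"
  assumes "psd_op P"
  shows "psd_op (adj_op L o\<^sub>L P o\<^sub>L L)"
  using assms by (simp add: psd_op_def inner_adj_op_left)

lemma norm_op_square:
  assumes "psd_op T"
  shows "(norm_op T x)\<^sup>2 = inner_op T x x"
  using assms by (simp add: norm_op_def inner_op_def psd_op_def)

text \<open>Symmetry merges the mixed terms; both sides are then the same quadratic polynomial in
  \<open>a\<close>, \<open>b\<close>, \<open>c\<close>.\<close>

lemma three_point_identity:
  fixes T :: "'u::real_inner \<Rightarrow>\<^sub>L 'u"
  assumes sym: "\<And>x y. inner (T x) y = inner (T y) x"
  shows "inner (T (a - b)) (a - c)
    = 1/2 * inner (T (a - b)) (a - b) + 1/2 * inner (T (a - c)) (a - c)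
      - 1/2 * inner (T (b - c)) (b - c)"
  using sym[of a b] sym[of a c] sym[of b c]
  by (simp add: blinfun.diff_right inner_diff_left inner_diff_right algebra_simps)

theorem theorem2p3:
  fixes N :: nat
    and H :: "nat \<Rightarrow> 'u::{real_inner, complete_space} \<Rightarrow> 'u set"
    and \<Gamma> M Z \<Lambda> :: "nat \<Rightarrow> 'u \<Rightarrow>\<^sub>L 'u"
    and u ubar z :: "nat \<Rightarrow> 'u"
    and uhat :: 'u
    and \<V> :: "nat \<Rightarrow> 'u \<Rightarrow> real"
  assumes N: "N \<ge> 1"
    and inv: "\<And>i. i \<le> N \<Longrightarrow> invertible_op (\<Lambda> (i + 1))"
    and ubar_0: "ubar 0 = u 0"
    and inclusion: "\<And>i. i < N \<Longrightarrow>
          0 \<in> (\<lambda>h. h + M (i + 1) (u (i + 1) - ubar i)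
                     + \<Gamma> (i + 1) ((inv_op (\<Lambda> (i + 1)) - id_blinfun) (u (i + 1) - u i)))
                ` H (i + 1) (u (i + 1))"
    and ubar_Suc: "\<And>i. i < N \<Longrightarrow>
          ubar (i + 1) = u (i + 1)
            + \<Lambda> (i + 2) ((inv_op (\<Lambda> (i + 1)) - id_blinfun) (u (i + 1) - u i))"
    and z_0: "z 0 = u 0"
    and z_Suc: "\<And>i. i < N \<Longrightarrow>
          z (i + 1) = inv_op (\<Lambda> (i + 1)) (u (i + 1)) - (inv_op (\<Lambda> (i + 1)) - id_blinfun) (u i)"
    and ZM: "\<And>i. i \<le> N \<Longrightarrow>
          (Z (i + 1) o\<^sub>L M (i + 1)) \<succeq> 0 \<and> selfadjoint_op (Z (i + 1) o\<^sub>L M (i + 1))"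
    and fundamental: "\<And>i h. i < N \<Longrightarrow> h \<in> H (i + 1) (u (i + 1)) \<Longrightarrow>
          inner_op (adj_op (\<Lambda> (i + 1)) o\<^sub>L Z (i + 1))
              (h - \<Gamma> (i + 1) (u (i + 1) - uhat)) (z (i + 1) - uhat)
          \<ge> \<V> (i + 1) uhat
            - 1 / 2 * (norm_op (adj_op (\<Lambda> (i + 1)) o\<^sub>L Z (i + 1) o\<^sub>L M (i + 1) o\<^sub>L \<Lambda> (i + 1))
                        (z (i + 1) - z i))\<^sup>2"
    and metric_update: "\<And>i. i < N \<Longrightarrow>
          (adj_op (\<Lambda> (i + 1)) o\<^sub>L Z (i + 1) o\<^sub>L ((M (i + 1) o\<^sub>L \<Lambda> (i + 1)) + 2 *\<^sub>R \<Gamma> (i + 1)))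
          \<succeq> (adj_op (\<Lambda> (i + 2)) o\<^sub>L Z (i + 2) o\<^sub>L M (i + 2) o\<^sub>L \<Lambda> (i + 2))"
  shows "1 / 2 * (norm_op (adj_op (\<Lambda> (N + 1)) o\<^sub>L Z (N + 1) o\<^sub>L M (N + 1) o\<^sub>L \<Lambda> (N + 1))
                    (z N - uhat))\<^sup>2
           + (\<Sum>i<N. \<V> (i + 1) uhat)
         \<le> 1 / 2 * (norm_op (adj_op (\<Lambda> 1) o\<^sub>L Z 1 o\<^sub>L M 1 o\<^sub>L \<Lambda> 1) (z 0 - uhat))\<^sup>2"
proof -
  define P where "P i = (adj_op (\<Lambda> i) o\<^sub>L Z i o\<^sub>L M i o\<^sub>L \<Lambda> i)" for i
  \<comment> \<open>Regrouping isolates the product of \<open>Z i\<close> and \<open>M i\<close>, to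
    which positivity and self-adjointness refer.\<close>
  have P_eq: "P i = adj_op (\<Lambda> i) o\<^sub>L (Z i o\<^sub>L M i) o\<^sub>L \<Lambda> i" for i
    by (rule blinfun_eqI) (simp add: P_def)
  have norm_P: "(norm_op (P (i + 1)) x)\<^sup>2 = inner (P (i + 1) x) x" if "i \<le> N" for i x
    using ZM[OF that] psd_op_congruence[of "Z (i + 1) o\<^sub>L M (i + 1)" "\<Lambda> (i + 1)"]
    by (simp add: P_eq ge_op_def norm_op_square inner_op_def)
  have P_sym: "inner (P (i + 1) x) y = inner (P (i + 1) y) x" if "i \<le> N" for i x y
    using selfadjoint_op_inner[of "Z (i + 1) o\<^sub>L M (i + 1)" "\<Lambda> (i + 1) x" "\<Lambda> (i + 1) y"] ZM[OF that]
    by (simp add: P_def inner_adj_op_left)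
  have z_diff: "z (i + 1) - u (i + 1) = (inv_op (\<Lambda> (i + 1)) - id_blinfun) (u (i + 1) - u i)"
    if "i < N" for i
    using z_Suc[OF that] by (simp add: blinfun.diff_left blinfun.diff_right)
  have \<Lambda>_z: "\<Lambda> (i + 1) (z (i + 1)) = u (i + 1) - u i + \<Lambda> (i + 1) (u i)" if "i < N" for i
    using inv[of i] z_Suc[OF that] that
    by (simp add: blinfun.diff_left blinfun.diff_right inv_op_right)
  have ubar: "ubar i = u i + \<Lambda> (i + 1) (z i - u i)" if "i < N" for i
  \<comment> \<open>At the start \<open>ubar 0 = z 0 = u 0\<close>, so the correction vanishes;
    afterwards the operator \<open>\<Lambda> (j + 2)\<close> in the update of \<open>ubar\<close> is
    \<open>\<Lambda> (i + 1)\<close> for \<open>i = j + 1\<close>.\<close>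
  proof (cases i)
    case 0
    then show ?thesis by (simp add: ubar_0 z_0)
  next
    case (Suc j)
    then show ?thesis using that ubar_Suc[of j] z_diff[of j] by simp
  qed
  have step: "1/2 * (norm_op (P (Suc i + 1)) (z (Suc i) - uhat))\<^sup>2 + \<V> (i + 1) uhat
      \<le> 1/2 * (norm_op (P (i + 1)) (z i - uhat))\<^sup>2" if i: "i < N" for i
  proof -
    let ?L = "\<Lambda> (i + 1)" and ?Z = "Z (i + 1)" and ?M = "M (i + 1)" and ?G = "\<Gamma> (i + 1)"
    let ?w = "z (i + 1) - uhat" and ?d = "z (i + 1) - z i"
    obtain h where h: "h \<in> H (i + 1) (u (i + 1))"
      and h0: "h + ?M (u (i + 1) - ubar i) + ?G (z (i + 1) - u (i + 1)) = 0"
      using inclusion[OF i] z_diff[OF i] by auto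
    have u_diff: "u (i + 1) - ubar i = ?L ?d"
      using \<Lambda>_z[OF i] ubar[OF i] by (simp add: blinfun.diff_right)
    \<comment> \<open>Splitting \<open>?w\<close> at \<open>u (i + 1)\<close> gives the
      \<open>?G\<close> term of the inclusion plus the one in the tested inequality.\<close>
    have "?G ?w = ?G (z (i + 1) - u (i + 1)) + ?G (u (i + 1) - uhat)"
      by (simp flip: blinfun.add_right)
    then have h_eq: "h - ?G (u (i + 1) - uhat) = - (?M (?L ?d) + ?G ?w)"
      using h0 unfolding u_diff by (simp add: algebra_simps add_eq_0_iff)
    have "\<V> (i + 1) uhat - 1/2 * inner (P (i + 1) ?d) ?d
        \<le> inner_op (adj_op ?L o\<^sub>L ?Z) (h - ?G (u (i + 1) - uhat)) ?w"
      using fundamental[OF i h] norm_P[of i ?d] i by (simp add: P_def)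
    also have "\<dots> = - inner (P (i + 1) ?d) ?w - inner (?Z (?G ?w)) (?L ?w)"
      unfolding h_eq inner_op_congruence
      by (simp add: P_def inner_adj_op_left blinfun.minus_right blinfun.add_right blinfun.diff_right[of "Z (Suc i)"]
          inner_diff_left inner_add_left)
    finally have test: "\<V> (i + 1) uhat - 1/2 * inner (P (i + 1) ?d) ?d
        \<le> - inner (P (i + 1) ?d) ?w - inner (?Z (?G ?w)) (?L ?w)" .
    \<comment> \<open>At \<open>?w\<close>, half of this bound absorbs exactly the \<open>?G\<close>
      term of \<open>test\<close>, thanks to the factor 2.\<close>
    have "0 \<le> inner (((adj_op ?L o\<^sub>L ?Z o\<^sub>L ((?M o\<^sub>L ?L) + 2 *\<^sub>R ?G)) - P (i + 2)) ?w) ?w"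
      using metric_update[OF i] by (simp add: ge_op_def psd_op_def P_def)
    then have "inner (P (i + 2) ?w) ?w \<le> inner (P (i + 1) ?w) ?w + 2 * inner (?Z (?G ?w)) (?L ?w)"
      by (simp add: P_def[of "i + 1"] P_def[of "Suc i"] inner_adj_op_left blinfun.diff_left
          blinfun.add_left blinfun.add_right blinfun.scaleR_left blinfun.scaleR_right
          inner_diff_left inner_add_left)
    \<comment> \<open>The \<open>?d\<close> term produced here cancels the one in
      \<open>test\<close>.\<close>
    moreover have "inner (P (i + 1) ?d) ?w = 1/2 * inner (P (i + 1) ?d) ?d
        + 1/2 * inner (P (i + 1) ?w) ?w - 1/2 * inner (P (i + 1) (z i - uhat)) (z i - uhat)"
      using P_sym[of i] i by (intro three_point_identity) simp
    ultimately show ?thesis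
      using test norm_P[of "Suc i" ?w] norm_P[of i "z i - uhat"] i by simp
  qed
  \<comment> \<open>Stated for every \<open>n \<le> N\<close>, so that each induction step adds one
    instance of \<open>step\<close>.\<close>
  have "1/2 * (norm_op (P (n + 1)) (z n - uhat))\<^sup>2 + (\<Sum>i<n. \<V> (i + 1) uhat)
      \<le> 1/2 * (norm_op (P 1) (z 0 - uhat))\<^sup>2" if "n \<le> N" for n
    using that
  proof (induction n)
    case 0
    then show ?case by simp
  next
    case (Suc n)
    then show ?case using step[of n] by simp
  qed
  from this[of N] show ?thesis by (simp add: P_def)
qed

end
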